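(* Let $A \in M_n(\mathbb{C})$ be a positive contraction with $\operatorname{tr}(A) = \alpha$. Then, for any real $c$ with $0 < c \leq 1-\alpha$ such that $cn$ is an integer, there is a subset $\sigma \subset [n]$ such that $$|\sigma| = cn \qquad\text{and}\qquad \|A_{\sigma}\| \leq \left(\sqrt{(1-c)\alpha}+\sqrt{c(1-\alpha)}\right)^2 .$$
   Context: $[n]=\{1,\dots,n\}$. A positive contraction is a hermitian matrix $A$ with $0\le A\le I$. $\operatorname{tr}=\frac1n\operatorname{Tr}$ is the normalized trace, $\|\cdot\|$ is the operator norm, and $A_\sigma$ is the $|\sigma|\times|\sigma|$ principal submatrix of $A$ with rows and columns indexed by $\sigma$. *)

theory Defs
  imports
    "Jordan_Normal_Form.Schur_Decomposition"
    "Jordan_Normal_Form.DL_Submatrix"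
    "HOL-Analysis.L2_Norm"
begin

text \<open>
  Rows and columns are indexed from \<open>0\<close>, so the index set \<open>{1,\<dots>,n}\<close> is rendered as
  \<open>{0..<n}\<close>. For \<open>\<sigma> \<subseteq> {0..<n}\<close>, \<open>submatrix A \<sigma> \<sigma>\<close> is the
  \<open>card \<sigma> \<times> card \<sigma>\<close> principal submatrix with the elements of \<open>\<sigma>\<close> in increasing order.
\<close>

definition hermitian_mat :: "complex mat \<Rightarrow> bool" where
  "hermitian_mat A \<longleftrightarrow> square_mat A \<and> mat_adjoint A = A"

text \<open>The inequality is the order on \<^typ>\<open>complex\<close> (real parts ordered, imaginary parts
  equal), i.e. it says that the inner product is real and nonnegative.\<close>

definition psd_mat :: "complex mat \<Rightarrow> bool" where
  "psd_mat A \<longleftrightarrow> hermitian_mat A \<and>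
     (\<forall>v \<in> carrier_vec (dim_row A). 0 \<le> (A *\<^sub>v v) \<bullet>c v)"

definition loewner_le :: "complex mat \<Rightarrow> complex mat \<Rightarrow> bool" where
  "loewner_le A B \<longleftrightarrow> dim_row A = dim_row B \<and> dim_col A = dim_col B \<and> psd_mat (B - A)"

definition positive_contraction :: "nat \<Rightarrow> complex mat \<Rightarrow> bool" where
  "positive_contraction n A \<longleftrightarrow>
     A \<in> carrier_mat n n \<and> hermitian_mat A \<and> loewner_le (0\<^sub>m n n) A \<and> loewner_le A (1\<^sub>m n)"

definition normalized_trace :: "complex mat \<Rightarrow> complex" where
  "normalized_trace A = (\<Sum>i<dim_row A. A $$ (i, i)) / of_nat (dim_row A)"

definition eucl_norm :: "complex vec \<Rightarrow> real" where
  "eucl_norm v = L2_set (\<lambda>i. cmod (v $ i)) {..<dim_vec v}"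

text \<open>The unit ball rather than the unit sphere is used so that the set is nonempty, and the
  norm is \<open>0\<close>, also for the empty matrix.\<close>

definition op_norm :: "complex mat \<Rightarrow> real" where
  "op_norm A = (SUP v \<in> {v \<in> carrier_vec (dim_col A). eucl_norm v \<le> 1}. eucl_norm (A *\<^sub>v v))"

lemma bdd_above_op_norm:
  "bdd_above ((\<lambda>v. eucl_norm (A *\<^sub>v v)) ` {v \<in> carrier_vec (dim_col A). eucl_norm v \<le> 1})"
proof (rule bdd_aboveI2)
  fix v assume "v \<in> {v \<in> carrier_vec (dim_col A). eucl_norm v \<le> 1}"
  then have v: "dim_vec v = dim_col A" and nv: "eucl_norm v \<le> 1" by auto
  have c: "cmod (v $ j) \<le> 1" if "j < dim_col A" for j
    using member_le_L2_set[of "{..<dim_vec v}" j "\<lambda>i. cmod (v $ i)"] that nv v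
    unfolding eucl_norm_def by auto
  have "eucl_norm (A *\<^sub>v v) \<le> (\<Sum>i<dim_row A. cmod ((A *\<^sub>v v) $ i))"
    unfolding eucl_norm_def dim_mult_mat_vec by (rule L2_set_le_sum) simp
  also have "\<dots> \<le> (\<Sum>i<dim_row A. \<Sum>j<dim_col A. cmod (A $$ (i, j)))"
  proof (rule sum_mono)
    fix i assume "i \<in> {..<dim_row A}"
    then have "(A *\<^sub>v v) $ i = (\<Sum>j<dim_col A. A $$ (i, j) * v $ j)"
      using v by (simp add: scalar_prod_def atLeast0LessThan)
    also have "cmod \<dots> \<le> (\<Sum>j<dim_col A. cmod (A $$ (i, j)))"
      by (rule sum_norm_le) (use c in \<open>auto simp: norm_mult intro!: mult_left_le\<close>)
    finally show "cmod ((A *\<^sub>v v) $ i) \<le> (\<Sum>j<dim_col A. cmod (A $$ (i, j)))" .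
  qed
  finally show "eucl_norm (A *\<^sub>v v) \<le> (\<Sum>i<dim_row A. \<Sum>j<dim_col A. cmod (A $$ (i, j)))" .
qed

end

theory Submission
  imports Defs "Jordan_Normal_Form.Spectral_Radius"
begin

text \<open>
  Rows and columns are deleted greedily, controlled by the barrier function
  \<open>\<Phi>\<^sub>B(b) = \<Sum> 1 / (b - e) = p'(b) / p(b)\<close>, where \<open>e\<close> runs over the eigenvalues of \<open>B\<close> and \<open>p\<close> is its
  characteristic polynomial. If \<open>B\<close> has size at least \<open>2\<close>, its eigenvalues are less than \<open>b\<close> and
  \<open>\<Phi>\<^sub>B(b) \<le> \<phi>\<close>, then they are even less than \<open>b - 1/\<phi>\<close>, and some index can be deleted such that the
  bounds persist with \<open>b - 1/\<phi>\<close> in place of \<open>b\<close>: by interlacing the eigenvalues stay below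
  \<open>b - 1/\<phi>\<close>, and a weighted mean of the barriers of the deletions is \<open>p'' / p'\<close>, which Jensen's
  inequality bounds by \<open>\<phi>\<close>. After \<open>(1 - c) n\<close> deletions the norm is at most \<open>b - (1 - c) n / \<phi>\<close>.
  Convexity gives \<open>\<phi> = n ((1 - \<alpha>) / b + \<alpha> / (b - 1))\<close> for \<open>A\<close>, and optimizing over \<open>b > 1\<close> yields the
  bound.
\<close>

section \<open>Norm and spectrum of Hermitian matrices\<close>

lemma cscalar_prod_self:
  "v \<bullet>c v = complex_of_real ((eucl_norm v)\<^sup>2)"
proof -
  have "v \<bullet>c v = (\<Sum>i<dim_vec v. complex_of_real ((cmod (v $ i))\<^sup>2))"
    unfolding scalar_prod_def
    by (intro sum.cong) (auto simp: complex_norm_square[symmetric] atLeast0LessThan)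
  then show ?thesis
    by (simp add: eucl_norm_def L2_set_def sum_nonneg)
qed

lemma eucl_norm_nonneg [simp]: "0 \<le> eucl_norm v"
  by (simp add: eucl_norm_def)

lemma eucl_norm_eq_0_iff:
  assumes "v \<in> carrier_vec n"
  shows "eucl_norm v = 0 \<longleftrightarrow> v = 0\<^sub>v n"
  using conjugate_square_eq_0_vec[OF assms] by (simp add: cscalar_prod_self)

lemma eucl_norm_smult: "eucl_norm (a \<cdot>\<^sub>v v) = cmod a * eucl_norm v"
proof -
  have "eucl_norm (a \<cdot>\<^sub>v v) = L2_set (\<lambda>i. cmod a * cmod (v $ i)) {..<dim_vec v}"
    unfolding eucl_norm_def by (auto simp: norm_mult intro: L2_set_cong)
  then show ?thesis
    by (simp add: eucl_norm_def L2_set_right_distrib)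
qed

lemma cscalar_prod_Cauchy_Schwarz:
  assumes "dim_vec u = dim_vec v"
  shows "cmod (u \<bullet>c v) \<le> eucl_norm u * eucl_norm v"
proof -
  have "cmod (u \<bullet>c v) \<le> (\<Sum>i<dim_vec v. \<bar>cmod (u $ i)\<bar> * \<bar>cmod (v $ i)\<bar>)"
    unfolding scalar_prod_def
    by (rule order_trans[OF norm_sum]) (auto simp: norm_mult atLeast0LessThan)
  also have "\<dots> \<le> eucl_norm u * eucl_norm v"
    unfolding eucl_norm_def assms by (rule L2_set_mult_ineq)
  finally show ?thesis .
qed

text \<open>Crude, but dependent on \<open>A\<close> only through an entrywise bound, hence uniform
  over all powers of a matrix that share one \<open>norm_bound\<close>.\<close>

lemma eucl_norm_mult_mat_vec_le:
  assumes A: "A \<in> carrier_mat n n" and v: "v \<in> carrier_vec n" and c: "norm_bound A c"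
  shows "eucl_norm (A *\<^sub>v v) \<le> real n * (c * (\<Sum>j<n. cmod (v $ j)))"
proof -
  have "eucl_norm (A *\<^sub>v v) \<le> (\<Sum>i<n. cmod ((A *\<^sub>v v) $ i))"
    unfolding eucl_norm_def dim_mult_mat_vec carrier_matD(1)[OF A] by (rule L2_set_le_sum) simp
  also have "\<dots> \<le> (\<Sum>i<n. c * (\<Sum>j<n. cmod (v $ j)))"
  proof (rule sum_mono)
    fix i assume i: "i \<in> {..<n}"
    then have "(A *\<^sub>v v) $ i = (\<Sum>j<n. A $$ (i, j) * v $ j)"
      using A v by (simp add: scalar_prod_def atLeast0LessThan)
    also have "cmod \<dots> \<le> (\<Sum>j<n. c * cmod (v $ j))"
      using A c i by (intro sum_norm_le) (auto simp: norm_mult norm_bound_def intro!: mult_right_mono)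
    finally show "cmod ((A *\<^sub>v v) $ i) \<le> c * (\<Sum>j<n. cmod (v $ j))"
      by (simp add: sum_distrib_left)
  qed
  finally show ?thesis by simp
qed

lemma hermitian_mat_iff:
  assumes "A \<in> carrier_mat n n"
  shows "hermitian_mat A \<longleftrightarrow> (\<forall>i<n. \<forall>j<n. cnj (A $$ (j, i)) = A $$ (i, j))"
proof -
  have "mat_adjoint A \<in> carrier_mat n n"
    using assms by (auto simp: mat_adjoint_def mat_of_rows_def)
  moreover have "mat_adjoint A $$ (i, j) = cnj (A $$ (j, i))" if "i < n" "j < n" for i j
    using assms that by (simp add: mat_adjoint_def mat_of_rows_index)
  ultimately have "mat_adjoint A = A \<longleftrightarrow> (\<forall>i<n. \<forall>j<n. cnj (A $$ (j, i)) = A $$ (i, j))"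
    using assms by (auto simp: mat_eq_iff)
  then show ?thesis
    using assms by (auto simp: hermitian_mat_def)
qed

lemma hermitian_cscalar_prod_swap:
  assumes A: "A \<in> carrier_mat n n" and h: "hermitian_mat A"
    and v: "v \<in> carrier_vec n" and w: "w \<in> carrier_vec n"
  shows "(A *\<^sub>v v) \<bullet>c w = v \<bullet>c (A *\<^sub>v w)"
proof -
  have "(A *\<^sub>v v) \<bullet>c w = (\<Sum>i<n. \<Sum>j<n. A $$ (i, j) * v $ j * cnj (w $ i))"
    using A v w by (simp add: scalar_prod_def atLeast0LessThan sum_distrib_right)
  also have "\<dots> = (\<Sum>j<n. \<Sum>i<n. A $$ (i, j) * v $ j * cnj (w $ i))"
    by (rule sum.swap)
  also have "\<dots> = (\<Sum>j<n. \<Sum>i<n. v $ j * cnj (A $$ (j, i) * w $ i))"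
  proof (intro sum.cong refl)
    fix i j assume "j \<in> {..<n}" "i \<in> {..<n}"
    then have "cnj (A $$ (j, i)) = A $$ (i, j)"
      using h unfolding hermitian_mat_iff[OF A] by blast
    then show "A $$ (i, j) * v $ j * cnj (w $ i) = v $ j * cnj (A $$ (j, i) * w $ i)"
      by simp
  qed
  also have "\<dots> = v \<bullet>c (A *\<^sub>v w)"
    using A v w by (simp add: scalar_prod_def atLeast0LessThan sum_distrib_left)
  finally show ?thesis .
qed

text \<open>The norms of \<open>M\<^sup>k v\<close> form a log-convex sequence, so they grow geometrically as soon as
  \<open>\<parallel>M v\<parallel> > \<parallel>v\<parallel>\<close>, whereas spectral radius below \<open>1\<close> keeps them bounded.\<close>

lemma hermitian_norm_le_spectral_radius_less_1:
  assumes M: "M \<in> carrier_mat n n" and h: "hermitian_mat M" and sr: "spectral_radius M < 1"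
    and v: "v \<in> carrier_vec n"
  shows "eucl_norm (M *\<^sub>v v) \<le> eucl_norm v"
proof (rule ccontr)
  assume "\<not> eucl_norm (M *\<^sub>v v) \<le> eucl_norm v"
  then have gt: "eucl_norm v < eucl_norm (M *\<^sub>v v)" by simp
  define w where "w k = M ^\<^sub>m k *\<^sub>v v" for k
  define a where "a k = eucl_norm (w k)" for k
  have w: "w k \<in> carrier_vec n" for k
    unfolding w_def using M v by (intro mult_mat_vec_carrier[of _ n n]) auto
  have pow: "M ^\<^sub>m Suc k = M * M ^\<^sub>m k" for k
  proof (induction k)
    case (Suc k)
    have "M ^\<^sub>m Suc (Suc k) = (M * M ^\<^sub>m k) * M" using Suc by simp
    also have "\<dots> = M * (M ^\<^sub>m k * M)" using M by (intro assoc_mult_mat) auto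
    finally show ?case by simp
  qed (use M in auto)
  have wS: "w (Suc k) = M *\<^sub>v w k" for k
    unfolding w_def pow using M v by (intro assoc_mult_mat_vec) auto
  have w0: "w 0 = v" using M v by (simp add: w_def)
  \<comment> \<open>Moving one factor \<open>M\<close> across the inner product rewrites the square
    as the product of \<open>w k\<close> and \<open>w (Suc (Suc k))\<close>; Cauchy-Schwarz bounds
    it.\<close>
  have conv: "(a (Suc k))\<^sup>2 \<le> a k * a (Suc (Suc k))" for k
  proof -
    have "complex_of_real ((a (Suc k))\<^sup>2) = (M *\<^sub>v w k) \<bullet>c w (Suc k)"
      unfolding a_def wS[symmetric] cscalar_prod_self ..
    also have "\<dots> = w k \<bullet>c w (Suc (Suc k))"
      using hermitian_cscalar_prod_swap[OF M h w[of k] w[of "Suc k"]] by (simp add: wS)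
    finally have "cmod (complex_of_real ((a (Suc k))\<^sup>2)) \<le> a k * a (Suc (Suc k))"
      using cscalar_prod_Cauchy_Schwarz[of "w k" "w (Suc (Suc k))"] w[of k] w[of "Suc (Suc k)"]
      unfolding a_def by simp
    then show ?thesis by (simp add: norm_power)
  qed
  have "v \<noteq> 0\<^sub>v n"
  proof
    assume "v = 0\<^sub>v n"
    then have "M *\<^sub>v v = 0\<^sub>v n" using M by (intro eq_vecI) (auto simp: scalar_prod_def)
    with gt \<open>v = 0\<^sub>v n\<close> show False by simp
  qed
  then have a0: "0 < a 0"
    using eucl_norm_eq_0_iff[OF v] by (simp add: a_def w0 order_less_le)
  define r where "r = a 1 / a 0"
  have r: "1 < r" unfolding r_def using a0 gt by (simp add: a_def w0 wS)
  \<comment> \<open>By \<open>conv\<close> the ratios of successive norms never decrease, so each is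
    at least the first one, \<open>r\<close>. Positivity is carried along to cancel
    \<open>a k\<close>.\<close>
  have grow: "0 < a k \<and> r * a k \<le> a (Suc k)" for k
  proof (induction k)
    case 0
    then show ?case using a0 by (simp add: r_def)
  next
    case (Suc k)
    have pos: "0 < a (Suc k)"
      using Suc r by (smt (verit) mult_pos_pos)
    have "r * a (Suc k) * a k \<le> a (Suc k) * a (Suc k)"
      using Suc pos by (simp add: mult.commute mult.left_commute)
    also have "\<dots> \<le> a (Suc (Suc k)) * a k"
      using conv[of k] by (simp add: power2_eq_square mult.commute)
    finally show ?case using Suc pos by simp
  qed
  have geo: "r ^ k * a 0 \<le> a k" for k
  proof (induction k)
    case (Suc k)
    have "r ^ Suc k * a 0 \<le> r * a k" using Suc r by simp
    with grow[of k] show ?case by linarith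
  qed simp
  obtain c where c: "norm_bound (M ^\<^sub>m k) c" for k
    using spectral_radius_jnf_norm_bound_less_1_upper_triangular[OF M sr] by auto
  define C where "C = real n * (c * (\<Sum>j<n. cmod (v $ j)))"
  have "a k \<le> C" for k
    unfolding a_def w_def C_def using M by (intro eucl_norm_mult_mat_vec_le[OF _ v c]) auto
  then have "r ^ k \<le> C / a 0" for k
    using order_trans[OF geo[of k]] a0 by (simp add: pos_le_divide_eq)
  moreover obtain k where "C / a 0 < r ^ k"
    using real_arch_pow[OF r] by blast
  ultimately show False by (meson linorder_not_le)
qed

lemma smult_mat_mult_vec:
  assumes "A \<in> carrier_mat m n" and "v \<in> carrier_vec n"
  shows "(k \<cdot>\<^sub>m A) *\<^sub>v v = k \<cdot>\<^sub>v (A *\<^sub>v v)"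
  using assms by (intro eq_vecI) (auto simp: scalar_prod_def sum_distrib_left mult.assoc)

text \<open>For every s > \<mu>, dividing \<open>A\<close> by s brings the spectral radius below 1,
  so the scaled matrix increases no norm; then s tends to \<mu>.\<close>

lemma hermitian_norm_le:
  assumes A: "A \<in> carrier_mat n n" and h: "hermitian_mat A"
    and ev: "\<And>e. eigenvalue A e \<Longrightarrow> cmod e \<le> \<mu>" and v: "v \<in> carrier_vec n"
  shows "eucl_norm (A *\<^sub>v v) \<le> \<mu> * eucl_norm v"
proof (cases "n = 0")
  case True
  then show ?thesis using A v by (simp add: eucl_norm_def)
next
  case False
  then obtain e where "eigenvalue A e"
    using spectrum_non_empty[OF A] by (auto simp: spectrum_def)
  then have mu: "0 \<le> \<mu>" using ev by (meson norm_ge_zero order_trans)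
  have step: "eucl_norm (A *\<^sub>v v) \<le> s * eucl_norm v" if s: "\<mu> < s" for s
  proof -
    have s0: "0 < s" using mu s by simp
    let ?M = "complex_of_real (1 / s) \<cdot>\<^sub>m A"
    have M: "?M \<in> carrier_mat n n" using A by simp
    have hM: "hermitian_mat ?M"
      unfolding hermitian_mat_iff[OF M]
      using A h unfolding hermitian_mat_iff[OF A] by simp
    have "spectral_radius ?M \<in> norm ` spectrum ?M"
      using spectral_radius_mem_max(1)[OF M] False by simp
    then obtain e where e: "eigenvalue ?M e" and sr: "spectral_radius ?M = cmod e"
      by (auto simp: spectrum_def)
    obtain u where u: "u \<in> carrier_vec n" "u \<noteq> 0\<^sub>v n" "?M *\<^sub>v u = e \<cdot>\<^sub>v u"
      using e M unfolding eigenvalue_def eigenvector_def by auto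
    have "A *\<^sub>v u = complex_of_real s \<cdot>\<^sub>v (?M *\<^sub>v u)"
      using A u(1) s0 by (auto simp: smult_mat_mult_vec[of _ n n] smult_smult_assoc)
    also have "\<dots> = (complex_of_real s * e) \<cdot>\<^sub>v u"
      by (simp only: u(3) smult_smult_assoc)
    finally have "eigenvalue A (complex_of_real s * e)"
      using u A unfolding eigenvalue_def eigenvector_def by auto
    from ev[OF this] have "s * cmod e \<le> \<mu>" using s0 by (simp add: norm_mult)
    with s have "s * cmod e < s * 1" by linarith
    then have "spectral_radius ?M < 1" unfolding mult_less_cancel_left_pos[OF s0] sr .
    from hermitian_norm_le_spectral_radius_less_1[OF M hM this v]
    have "eucl_norm (complex_of_real (1 / s) \<cdot>\<^sub>v (A *\<^sub>v v)) \<le> eucl_norm v"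
      using A v by (simp add: smult_mat_mult_vec[of _ n n])
    then show ?thesis
      using s0 by (simp add: eucl_norm_smult norm_divide divide_le_eq mult.commute)
  qed
  show ?thesis
  proof (rule field_le_epsilon)
    fix \<epsilon> :: real assume eps: "0 < \<epsilon>"
    \<comment> \<open>Chosen so that s - \<mu> times the norm of \<open>v\<close> is at most
      \<epsilon>; the summand 1 keeps the denominator positive for \<open>v\<close> zero.\<close>
    define s where "s = \<mu> + \<epsilon> / (eucl_norm v + 1)"
    have pos: "0 < eucl_norm v + 1" by (simp add: add_nonneg_pos)
    have "\<mu> < s" using eps pos by (simp add: s_def)
    from step[OF this] have "eucl_norm (A *\<^sub>v v) \<le> \<mu> * eucl_norm v + \<epsilon> * (eucl_norm v / (eucl_norm v + 1))"
      by (simp add: s_def algebra_simps)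
    also have "\<dots> \<le> \<mu> * eucl_norm v + \<epsilon> * 1"
      using eps pos by (intro add_left_mono mult_left_mono) auto
    finally show "eucl_norm (A *\<^sub>v v) \<le> \<mu> * eucl_norm v + \<epsilon>" by simp
  qed
qed

section \<open>Spectra of positive semidefinite matrices\<close>

lemma psd_mat_eigenvalue:
  assumes A: "A \<in> carrier_mat n n" and psd: "psd_mat A" and e: "eigenvalue A e"
  obtains r where "0 \<le> r" "e = complex_of_real r"
proof -
  obtain u where u: "u \<in> carrier_vec n" "u \<noteq> 0\<^sub>v n" "A *\<^sub>v u = e \<cdot>\<^sub>v u"
    using e A unfolding eigenvalue_def eigenvector_def by auto
  have "(A *\<^sub>v u) \<bullet>c u = e * complex_of_real ((eucl_norm u)\<^sup>2)"
    using u by (simp add: cscalar_prod_self)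
  moreover have "0 \<le> (A *\<^sub>v u) \<bullet>c u"
    using psd A u unfolding psd_mat_def by auto
  ultimately have "0 \<le> e * complex_of_real ((eucl_norm u)\<^sup>2)" by simp
  moreover have "0 < (eucl_norm u)\<^sup>2"
    using u eucl_norm_eq_0_iff[OF u(1)] by simp
  ultimately have "0 \<le> Re e" "Im e = 0"
    by (auto simp: less_eq_complex_def zero_le_mult_iff)
  then show ?thesis
    by (intro that[of "Re e"]) (auto simp: complex_eq_iff)
qed

text \<open>All complex roots are eigenvalues, hence real and nonnegative, and can be stored as
  reals. A list keeps the multiplicities, which the barrier and the trace count.\<close>

lemma psd_mat_char_poly_factorized:
  assumes A: "A \<in> carrier_mat n n" and psd: "psd_mat A"
  obtains es where "char_poly A = (\<Prod>e\<leftarrow>es. [:- complex_of_real e, 1:])" "length es = n"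
    "\<And>e. e \<in> set es \<Longrightarrow> 0 \<le> e"
    "\<And>e. eigenvalue A (complex_of_real e) \<longleftrightarrow> e \<in> set es"
proof -
  obtain as where as: "char_poly A = (\<Prod>a\<leftarrow>as. [:- a, 1:])" "length as = n"
    using char_poly_factorized[OF A] by blast
  have ev: "eigenvalue A a \<longleftrightarrow> a \<in> set as" for a
    unfolding eigenvalue_root_char_poly[OF A] as(1) poly_prod_list prod_list_zero_iff by auto
  have real: "complex_of_real (Re a) = a \<and> 0 \<le> Re a" if "a \<in> set as" for a
    using psd_mat_eigenvalue[OF A psd, of a] that ev by (metis Re_complex_of_real)
  have map: "map complex_of_real (map Re as) = as"
    using real by (simp add: map_idI)
  have "char_poly A = (\<Prod>e\<leftarrow>map Re as. [:- complex_of_real e, 1:])"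
    unfolding as(1) by (subst map[symmetric]) (simp add: comp_def)
  moreover have "eigenvalue A (complex_of_real e) \<longleftrightarrow> e \<in> set (map Re as)" for e
    unfolding ev using real by (metis Re_complex_of_real imageE imageI list.set_map)
  ultimately show ?thesis
    using as(2) real by (intro that[of "map Re as"]) auto
qed

section \<open>Deleting a row and the matching column\<close>

lemma sum_insert_index:
  fixes f :: "nat \<Rightarrow> 'a::comm_monoid_add"
  assumes "i < Suc d"
  shows "(\<Sum>j<Suc d. f j) = f i + (\<Sum>j<d. f (insert_index i j))"
proof -
  have "(\<Sum>j<Suc d. f j) = f i + sum f ({0..<Suc d} - {i})"
    using assms by (subst sum.remove[of _ i]) (auto simp: atLeast0LessThan)
  also have "sum f ({0..<Suc d} - {i}) = (\<Sum>j<d. f (insert_index i j))"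
    unfolding insert_index_image[OF assms, symmetric]
    by (subst sum.reindex[OF insert_index_inj_on]) (simp add: atLeast0LessThan)
  finally show ?thesis .
qed

text \<open>The witness is \<open>u\<close> padded with a zero at position \<open>i\<close>: the
  deletion is the compression of \<open>B\<close> to a coordinate hyperplane.\<close>

lemma mat_delete_quadratic_form:
  assumes B: "B \<in> carrier_mat (Suc d) (Suc d)" and i: "i < Suc d" and u: "u \<in> carrier_vec d"
  obtains v where "v \<in> carrier_vec (Suc d)" "eucl_norm v = eucl_norm u"
    "(B *\<^sub>v v) \<bullet>c v = (mat_delete B i i *\<^sub>v u) \<bullet>c u"
proof
  define v where "v = vec (Suc d) (\<lambda>j. if j = i then 0 else u $ delete_index i j)"
  let ?C = "mat_delete B i i"
  have C: "?C \<in> carrier_mat d d" using mat_delete_carrier[OF B, of i i] by simp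
  have less: "insert_index i j < Suc d" if "j < d" for j
    using that by (simp add: insert_index_def)
  have vi: "v $ i = 0" using i by (simp add: v_def)
  have vj: "v $ insert_index i j = u $ j" if "j < d" for j
    using less[OF that] by (simp add: v_def)
  show v: "v \<in> carrier_vec (Suc d)" by (simp add: v_def)
  have "v \<bullet>c v = (\<Sum>j<Suc d. v $ j * cnj (v $ j))"
    using v by (simp add: scalar_prod_def atLeast0LessThan)
  also have "\<dots> = u \<bullet>c u"
    unfolding sum_insert_index[OF i] using u by (simp add: vi vj scalar_prod_def atLeast0LessThan)
  finally have "(eucl_norm v)\<^sup>2 = (eucl_norm u)\<^sup>2"
    unfolding cscalar_prod_self of_real_eq_iff .
  then show "eucl_norm v = eucl_norm u"
    by (rule power2_eq_imp_eq) simp_all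
  have Bv: "(B *\<^sub>v v) $ insert_index i j = (?C *\<^sub>v u) $ j" if j: "j < d" for j
  proof -
    have "(B *\<^sub>v v) $ insert_index i j = (\<Sum>k<Suc d. B $$ (insert_index i j, k) * v $ k)"
      using B v less[OF j] by (simp add: scalar_prod_def atLeast0LessThan)
    also have "\<dots> = (\<Sum>k<d. ?C $$ (j, k) * u $ k)"
      unfolding sum_insert_index[OF i] using mat_delete_index[OF B i i j] by (simp add: vi vj)
    also have "\<dots> = (?C *\<^sub>v u) $ j"
      using B C u j by (simp add: scalar_prod_def atLeast0LessThan)
    finally show ?thesis .
  qed
  have "(B *\<^sub>v v) \<bullet>c v = (\<Sum>j<Suc d. (B *\<^sub>v v) $ j * cnj (v $ j))"
    using B v by (simp add: scalar_prod_def atLeast0LessThan)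
  also have "\<dots> = (\<Sum>j<d. (?C *\<^sub>v u) $ j * cnj (u $ j))"
    unfolding sum_insert_index[OF i] by (simp add: vi vj Bv del: index_mult_mat_vec)
  also have "\<dots> = (?C *\<^sub>v u) \<bullet>c u"
    using C u by (simp add: scalar_prod_def atLeast0LessThan)
  finally show "(B *\<^sub>v v) \<bullet>c v = (?C *\<^sub>v u) \<bullet>c u" .
qed

lemma psd_mat_delete:
  assumes B: "B \<in> carrier_mat (Suc d) (Suc d)" and psd: "psd_mat B" and i: "i < Suc d"
  shows "psd_mat (mat_delete B i i)"
proof -
  have C: "mat_delete B i i \<in> carrier_mat d d" using mat_delete_carrier[OF B, of i i] by simp
  have "hermitian_mat (mat_delete B i i)"
    using psd unfolding psd_mat_def hermitian_mat_iff[OF B] hermitian_mat_iff[OF C]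
    by (auto simp: mat_delete_index[OF B i i, symmetric] insert_index_def)
  moreover have "0 \<le> (mat_delete B i i *\<^sub>v u) \<bullet>c u" if "u \<in> carrier_vec d" for u
    using mat_delete_quadratic_form[OF B i that] psd B unfolding psd_mat_def
    by (metis carrier_matD(1))
  ultimately show ?thesis
    unfolding psd_mat_def using C by auto
qed

text \<open>The part of Cauchy interlacing that the deletions need. Padding an eigenvector of the
  deletion with a zero exhibits \<open>f\<close> as a Rayleigh quotient of \<open>B\<close>, whose
  norm is at most \<mu>.\<close>

lemma eigenvalue_mat_delete_le:
  assumes B: "B \<in> carrier_mat (Suc d) (Suc d)" and h: "hermitian_mat B" and i: "i < Suc d"
    and ev: "\<And>e. eigenvalue B e \<Longrightarrow> cmod e \<le> \<mu>"
    and f: "eigenvalue (mat_delete B i i) (complex_of_real f)"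
  shows "f \<le> \<mu>"
proof -
  have C: "mat_delete B i i \<in> carrier_mat d d" using mat_delete_carrier[OF B, of i i] by simp
  obtain u where u: "u \<in> carrier_vec d" "u \<noteq> 0\<^sub>v d"
      "mat_delete B i i *\<^sub>v u = complex_of_real f \<cdot>\<^sub>v u"
    using f C unfolding eigenvalue_def eigenvector_def by auto
  obtain v where v: "v \<in> carrier_vec (Suc d)" "eucl_norm v = eucl_norm u"
      "(B *\<^sub>v v) \<bullet>c v = (mat_delete B i i *\<^sub>v u) \<bullet>c u"
    using mat_delete_quadratic_form[OF B i u(1)] by blast
  have "complex_of_real (f * (eucl_norm u)\<^sup>2) = (B *\<^sub>v v) \<bullet>c v"
    unfolding v(3) u(3) using u(1) by (simp add: cscalar_prod_self)
  then have "f * (eucl_norm u)\<^sup>2 \<le> cmod ((B *\<^sub>v v) \<bullet>c v)"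
    by (metis abs_ge_self norm_of_real)
  also have "\<dots> \<le> eucl_norm (B *\<^sub>v v) * eucl_norm v"
    using B v(1) by (intro cscalar_prod_Cauchy_Schwarz) auto
  also have "\<dots> \<le> \<mu> * eucl_norm v * eucl_norm v"
    using hermitian_norm_le[OF B h ev v(1)] by (intro mult_right_mono) auto
  finally have "f * (eucl_norm u)\<^sup>2 \<le> \<mu> * (eucl_norm u)\<^sup>2"
    by (simp add: v(2) power2_eq_square mult.assoc)
  moreover have "0 < (eucl_norm u)\<^sup>2"
    using u eucl_norm_eq_0_iff[OF u(1)] by simp
  ultimately show ?thesis by simp
qed

section \<open>Barrier functions\<close>

text \<open>Logarithmic differentiation: the sum of 1 / (x - e) is p' / p, and its derivative, minus
  the sum of the squares, is p'' / p - (p' / p)^2.\<close>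

lemma poly_pderiv_linear_factors:
  fixes x :: "'a::field"
  assumes "x \<notin> set es"
  defines "p \<equiv> (\<Prod>e\<leftarrow>es. [:- e, 1:])"
  shows "poly (pderiv p) x = poly p x * (\<Sum>e\<leftarrow>es. 1 / (x - e))"
    and "poly (pderiv (pderiv p)) x =
      poly p x * ((\<Sum>e\<leftarrow>es. 1 / (x - e))\<^sup>2 - (\<Sum>e\<leftarrow>es. 1 / (x - e)\<^sup>2))"
proof -
  have "poly (pderiv p) x = poly p x * (\<Sum>e\<leftarrow>es. 1 / (x - e)) \<and>
    poly (pderiv (pderiv p)) x =
      poly p x * ((\<Sum>e\<leftarrow>es. 1 / (x - e))\<^sup>2 - (\<Sum>e\<leftarrow>es. 1 / (x - e)\<^sup>2))"
    using assms(1) unfolding p_def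
  proof (induction es)
    case (Cons a es)
    define L where "L = [:- a, 1:]"
    define q where "q = (\<Prod>e\<leftarrow>es. [:- e, 1:])"
    define T1 where "T1 = (\<Sum>e\<leftarrow>es. 1 / (x - e))"
    define T2 where "T2 = (\<Sum>e\<leftarrow>es. 1 / (x - e)\<^sup>2)"
    have L: "pderiv L = 1" "poly L x = x - a"
      by (simp_all add: L_def pderiv_pCons)
    have xa: "x - a \<noteq> 0" using Cons.prems by auto
    have q: "poly (pderiv q) x = poly q x * T1"
      "poly (pderiv (pderiv q)) x = poly q x * (T1\<^sup>2 - T2)"
      using Cons by (auto simp: q_def T1_def T2_def)
    have "poly (pderiv (L * q)) x = poly (L * q) x * (1 / (x - a) + T1)"
      using xa by (simp add: pderiv_mult L q field_simps)
    moreover have "poly (pderiv (pderiv (L * q))) x =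
        2 * (poly q x * T1) + (x - a) * (poly q x * (T1\<^sup>2 - T2))"
      by (simp add: pderiv_mult pderiv_add L q algebra_simps)
    moreover have "\<dots> = poly (L * q) x * ((1 / (x - a) + T1)\<^sup>2 - (1 / (x - a)\<^sup>2 + T2))"
    proof -
      define t where "t = 1 / (x - a)"
      have t: "(x - a) * t = 1" "1 / (x - a)\<^sup>2 = t\<^sup>2"
        using xa by (simp_all add: t_def power_one_over)
      have "(x - a) * poly q x * ((t + T1)\<^sup>2 - (t\<^sup>2 + T2)) =
          2 * ((x - a) * t) * (poly q x * T1) + (x - a) * (poly q x * (T1\<^sup>2 - T2))"
        by (simp add: power2_eq_square algebra_simps)
      then show ?thesis
        unfolding poly_mult L(2) t t_def[symmetric] by simp
    qed
    ultimately show ?case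
      by (simp only: list.map prod_list.Cons sum_list.Cons L_def q_def T1_def T2_def)
  qed simp
  then show "poly (pderiv p) x = poly p x * (\<Sum>e\<leftarrow>es. 1 / (x - e))"
    and "poly (pderiv (pderiv p)) x =
      poly p x * ((\<Sum>e\<leftarrow>es. 1 / (x - e))\<^sup>2 - (\<Sum>e\<leftarrow>es. 1 / (x - e)\<^sup>2))" by auto
qed

lemma poly_linear_factors_of_real:
  "poly (\<Prod>e\<leftarrow>es. [:- complex_of_real e, 1:]) (complex_of_real x) = complex_of_real (\<Prod>e\<leftarrow>es. x - e)"
  by (induction es) (auto simp: algebra_simps)

lemma prod_list_diff_pos:
  fixes x :: real
  assumes "\<forall>e\<in>set es. e < x"
  shows "0 < (\<Prod>e\<leftarrow>es. x - e)"
  using assms by (induction es) auto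

text \<open>Lets identities between complex characteristic polynomials be read as identities between
  reals, which can then be compared by order.\<close>

lemma poly_pderiv_linear_factors_of_real:
  assumes "\<forall>e\<in>set es. e < x"
  defines "p \<equiv> (\<Prod>e\<leftarrow>es. [:- complex_of_real e, 1:])"
  shows "poly (pderiv p) (complex_of_real x) =
      complex_of_real ((\<Prod>e\<leftarrow>es. x - e) * (\<Sum>e\<leftarrow>es. 1 / (x - e)))"
    and "poly (pderiv (pderiv p)) (complex_of_real x) = complex_of_real
      ((\<Prod>e\<leftarrow>es. x - e) * ((\<Sum>e\<leftarrow>es. 1 / (x - e))\<^sup>2 - (\<Sum>e\<leftarrow>es. 1 / (x - e)\<^sup>2)))"
proof -
  have nin: "complex_of_real x \<notin> set (map complex_of_real es)" using assms(1) by auto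
  have p: "p = (\<Prod>e\<leftarrow>map complex_of_real es. [:- e, 1:])"
    unfolding p_def by (simp add: comp_def)
  have s: "(\<Sum>e\<leftarrow>map complex_of_real es. 1 / (complex_of_real x - e) ^ k) =
      complex_of_real (\<Sum>e\<leftarrow>es. 1 / (x - e) ^ k)" for k
    by (induction es) auto
  have px: "poly p (complex_of_real x) = complex_of_real (\<Prod>e\<leftarrow>es. x - e)"
    unfolding p_def by (rule poly_linear_factors_of_real)
  show "poly (pderiv p) (complex_of_real x) =
      complex_of_real ((\<Prod>e\<leftarrow>es. x - e) * (\<Sum>e\<leftarrow>es. 1 / (x - e)))"
    using poly_pderiv_linear_factors(1)[OF nin, folded p] s[of 1] by (simp add: px)
  show "poly (pderiv (pderiv p)) (complex_of_real x) = complex_of_real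
      ((\<Prod>e\<leftarrow>es. x - e) * ((\<Sum>e\<leftarrow>es. 1 / (x - e))\<^sup>2 - (\<Sum>e\<leftarrow>es. 1 / (x - e)\<^sup>2)))"
    using poly_pderiv_linear_factors(2)[OF nin, folded p] s[of 1] s[of 2] by (simp add: px)
qed

lemma barrier_pos:
  fixes x :: real
  assumes "es \<noteq> []" and "\<forall>e\<in>set es. e < x"
  shows "0 < (\<Sum>e\<leftarrow>es. 1 / (x - e))"
  using assms
proof (induction es)
  case (Cons a es)
  then show ?case by (cases "es = []") (auto simp: add_pos_pos)
qed simp

text \<open>Jensen's inequality for the convex function \<open>a \<mapsto> 1 / (1 + \<delta> a)\<close> with weights \<open>a = 1 / (x - e)\<close>;
  \<open>s\<close> is the value of this function at the weighted mean of \<open>a\<close>.\<close>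

lemma barrier_shift:
  fixes x \<delta> :: real
  assumes ne: "es \<noteq> []" and less: "\<forall>e\<in>set es. e < x" and \<delta>: "0 < \<delta>"
    and le: "(\<Sum>e\<leftarrow>es. 1 / (x + \<delta> - e)) \<le> 1 / \<delta>"
  defines "S1 \<equiv> (\<Sum>e\<leftarrow>es. 1 / (x - e))" and "S2 \<equiv> (\<Sum>e\<leftarrow>es. 1 / (x - e)\<^sup>2)"
  shows "S1\<^sup>2 - S2 \<le> S1 / \<delta>"
proof -
  have S: "0 < S1" "0 \<le> S2"
    unfolding S1_def S2_def using barrier_pos[OF ne less] by (auto intro!: sum_list_nonneg)
  define D where "D = S1 + \<delta> * S2"
  have D: "0 < D" unfolding D_def using S \<delta> by (simp add: add_pos_nonneg)
  define s where "s = S1 / D"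
  \<comment> \<open>With a = 1 / (x - e), the summand is the weight a times 2 s - s^2 (1 + \<delta>
    a), the tangent to 1 / (1 + \<delta> a) where that function takes the value \<open>s\<close>. It
    lies below the function; the gap is computed as a square over a positive denominator.\<close>
  have "2 * s * S1 - s\<^sup>2 * D = (\<Sum>e\<leftarrow>es. 2 * s * (1 / (x - e)) - s\<^sup>2 * (1 / (x - e) + \<delta> * (1 / (x - e)\<^sup>2)))"
    unfolding D_def S1_def S2_def by (induction es) (auto simp: algebra_simps)
  also have "\<dots> \<le> (\<Sum>e\<leftarrow>es. 1 / (x + \<delta> - e))"
  proof (rule sum_list_mono)
    fix e assume "e \<in> set es"
    then have y: "0 < x - e" using less by simp
    define y where "y = x - e"
    have "1 / (y + \<delta>) - (2 * s * (1 / y) - s\<^sup>2 * (1 / y + \<delta> * (1 / y\<^sup>2)))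
        = (y - s * (y + \<delta>))\<^sup>2 / (y\<^sup>2 * (y + \<delta>))"
      using y \<delta> by (simp add: y_def[symmetric] divide_simps add_pos_pos) (simp add: power2_eq_square algebra_simps)
    also have "\<dots> \<ge> 0" using y \<delta> by (simp add: y_def)
    finally show "2 * s * (1 / (x - e)) - s\<^sup>2 * (1 / (x - e) + \<delta> * (1 / (x - e)\<^sup>2)) \<le> 1 / (x + \<delta> - e)"
      by (simp add: y_def algebra_simps)
  qed
  also note le
  also have "2 * s * S1 - s\<^sup>2 * D = S1\<^sup>2 / D"
    using D by (simp add: s_def field_simps power2_eq_square)
  finally have "S1\<^sup>2 * \<delta> \<le> S1 + \<delta> * S2"
    using D \<delta> by (simp add: D_def field_simps)
  then show "S1\<^sup>2 - S2 \<le> S1 / \<delta>" using \<delta> by (simp add: field_simps)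
qed

text \<open>The list holds the eigenvalues as reals, with multiplicity. Keeping them strictly below
  \<open>b\<close> makes every summand positive and excludes division by zero.\<close>

definition barrier_le :: "complex mat \<Rightarrow> real \<Rightarrow> real \<Rightarrow> bool" where
  "barrier_le B b \<phi> \<longleftrightarrow> (\<exists>es. char_poly B = (\<Prod>e\<leftarrow>es. [:- complex_of_real e, 1:]) \<and>
     (\<forall>e\<in>set es. e < b) \<and> (\<Sum>e\<leftarrow>es. 1 / (b - e)) \<le> \<phi>)"

text \<open>With \<open>p\<close> the characteristic polynomial of \<open>B\<close> and \<open>q\<^sub>i\<close> those of the deletions, \<open>p' = \<Sum> q\<^sub>i\<close>
  and \<open>p'' = \<Sum> q\<^sub>i'\<close>. At the shifted point all \<open>q\<^sub>i\<close> are positive, so some \<open>q\<^sub>i' / q\<^sub>i\<close> is at most the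
  weighted mean \<open>p'' / p'\<close>.\<close>

lemma barrier_le_mat_delete:
  assumes B: "B \<in> carrier_mat (Suc d) (Suc d)" and psd: "psd_mat B" and d: "0 < d"
    and \<phi>: "0 < \<phi>" and bar: "barrier_le B b \<phi>"
  obtains i where "i < Suc d" "barrier_le (mat_delete B i i) (b - 1 / \<phi>) \<phi>"
proof -
  define x where "x = b - 1 / \<phi>"
  obtain es where es: "char_poly B = (\<Prod>e\<leftarrow>es. [:- complex_of_real e, 1:])"
      "\<forall>e\<in>set es. e < b" "(\<Sum>e\<leftarrow>es. 1 / (b - e)) \<le> \<phi>"
    using bar unfolding barrier_le_def by blast
  have len: "length es = Suc d"
  proof -
    have "degree (char_poly B) = length es"
      unfolding es(1) using degree_linear_factors[of uminus "map complex_of_real es"]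
      by (simp add: comp_def)
    then show ?thesis using degree_monic_char_poly[OF B] by simp
  qed
  have ev: "eigenvalue B a \<Longrightarrow> a \<in> complex_of_real ` set es" for a
    unfolding eigenvalue_root_char_poly[OF B] es(1) poly_prod_list prod_list_zero_iff by auto
  have ev': "e \<in> set es \<Longrightarrow> eigenvalue B (complex_of_real e)" for e
    unfolding eigenvalue_root_char_poly[OF B] es(1) poly_prod_list prod_list_zero_iff by force
  have nonneg: "0 \<le> e" if "e \<in> set es" for e
    using psd_mat_eigenvalue[OF B psd ev'[OF that]] by (metis of_real_eq_iff)
  \<comment> \<open>The size is at least 2, so another positive summand exists and 1 / (b - e) is
    strictly smaller than \<phi>.\<close>
  have less: "e < x" if e: "e \<in> set es" for e
  proof -
    obtain us vs where split: "es = us @ e # vs"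
      using split_list[OF e] by blast
    have "us @ vs \<noteq> []" using len d split by (cases us; cases vs) auto
    then have "0 < (\<Sum>e\<leftarrow>us @ vs. 1 / (b - e))"
      using es(2) split by (intro barrier_pos) auto
    then have "1 / (b - e) < \<phi>" using es(3) split by simp
    then show ?thesis using es(2) e \<phi> by (simp add: x_def field_simps)
  qed
  \<comment> \<open>Interlacing gives only a non-strict bound; applied with the largest eigenvalue,
    which is below \<open>x\<close>, it keeps the eigenvalues of all deletions strictly below
    \<open>x\<close>.\<close>
  define \<rho> where "\<rho> = Max (set es)"
  have ne: "es \<noteq> []" using len by auto
  have \<rho>: "\<rho> < x" using less ne by (simp add: \<rho>_def)
  have rad: "cmod a \<le> \<rho>" if "eigenvalue B a" for a
    using ev[OF that] nonneg ne by (auto simp: \<rho>_def)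
  have h: "hermitian_mat B" using psd by (simp add: psd_mat_def)
  let ?C = "\<lambda>i. mat_delete B i i"
  have C: "?C i \<in> carrier_mat d d" for i using mat_delete_carrier[OF B, of i i] by simp
  have "\<exists>fs. char_poly (?C i) = (\<Prod>e\<leftarrow>fs. [:- complex_of_real e, 1:]) \<and> (\<forall>f\<in>set fs. f < x)"
    if i: "i < Suc d" for i
  proof -
    obtain fs where "char_poly (?C i) = (\<Prod>e\<leftarrow>fs. [:- complex_of_real e, 1:])"
      "\<And>f. eigenvalue (?C i) (complex_of_real f) \<longleftrightarrow> f \<in> set fs"
      using psd_mat_char_poly_factorized[OF C psd_mat_delete[OF B psd i]] by metis
    moreover from this(2) have "\<forall>f\<in>set fs. f < x"
      using eigenvalue_mat_delete_le[OF B h i rad] \<rho> by fastforce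
    ultimately show ?thesis by blast
  qed
  then obtain fs where fs: "\<And>i. i < Suc d \<Longrightarrow> char_poly (?C i) = (\<Prod>e\<leftarrow>fs i. [:- complex_of_real e, 1:])"
      "\<And>i. i < Suc d \<Longrightarrow> \<forall>f\<in>set (fs i). f < x"
    by metis
  define P where "P = (\<Prod>e\<leftarrow>es. x - e)"
  define S1 where "S1 = (\<Sum>e\<leftarrow>es. 1 / (x - e))"
  define S2 where "S2 = (\<Sum>e\<leftarrow>es. 1 / (x - e)\<^sup>2)"
  define Q where "Q i = (\<Prod>e\<leftarrow>fs i. x - e)" for i
  define T where "T i = (\<Sum>e\<leftarrow>fs i. 1 / (x - e))" for i
  have P: "0 < P" unfolding P_def using less by (intro prod_list_diff_pos) auto
  have Q: "0 < Q i" if "i < Suc d" for i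
    unfolding Q_def using fs(2)[OF that] by (rule prod_list_diff_pos)
  have less': "\<forall>e\<in>set es. e < x" using less by blast
  note dp = pderiv_char_poly[OF B]
  have "complex_of_real (P * S1) = poly (pderiv (char_poly B)) (complex_of_real x)"
    unfolding es(1) P_def S1_def using poly_pderiv_linear_factors_of_real(1)[OF less'] by simp
  also have "\<dots> = (\<Sum>i<Suc d. complex_of_real (Q i))"
    unfolding dp poly_sum Q_def by (intro sum.cong refl) (simp only: fs(1) lessThan_iff poly_linear_factors_of_real)
  finally have e1: "P * S1 = (\<Sum>i<Suc d. Q i)"
    unfolding of_real_sum[symmetric] of_real_eq_iff .
  have "complex_of_real (P * (S1\<^sup>2 - S2)) = poly (pderiv (pderiv (char_poly B))) (complex_of_real x)"
    unfolding es(1) P_def S1_def S2_def using poly_pderiv_linear_factors_of_real(2)[OF less'] by simp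
  also have "\<dots> = (\<Sum>i<Suc d. complex_of_real (Q i * T i))"
    unfolding dp pderiv_sum poly_sum Q_def T_def
  proof (intro sum.cong refl)
    fix i assume "i \<in> {..<Suc d}"
    then have i: "i < Suc d" by simp
    show "poly (pderiv (char_poly (?C i))) (complex_of_real x) =
        complex_of_real ((\<Prod>e\<leftarrow>fs i. x - e) * (\<Sum>e\<leftarrow>fs i. 1 / (x - e)))"
      unfolding fs(1)[OF i] by (rule poly_pderiv_linear_factors_of_real(1)[OF fs(2)[OF i]])
  qed
  finally have e2: "P * (S1\<^sup>2 - S2) = (\<Sum>i<Suc d. Q i * T i)"
    unfolding of_real_sum[symmetric] of_real_eq_iff .
  \<comment> \<open>As x + 1 / \<phi> is \<open>b\<close>, the barrier bound at \<open>b\<close> is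
    exactly the hypothesis of \<open>barrier_shift\<close> for \<delta> = 1 / \<phi>.\<close>
  have le: "(\<Sum>e\<leftarrow>es. 1 / (x + 1 / \<phi> - e)) \<le> 1 / (1 / \<phi>)"
    using es(3) by (simp add: x_def)
  have "S1\<^sup>2 - S2 \<le> S1 / (1 / \<phi>)"
    unfolding S1_def S2_def by (rule barrier_shift[OF ne less' _ le]) (use \<phi> in simp)
  then have "P * (S1\<^sup>2 - S2) \<le> P * (S1 * \<phi>)"
    using P by simp
  then have *: "(\<Sum>i<Suc d. Q i * T i) \<le> (\<Sum>i<Suc d. Q i * \<phi>)"
    unfolding e2 sum_distrib_right[symmetric] e1[symmetric] by (simp add: mult.assoc)
  have "\<exists>i<Suc d. T i \<le> \<phi>"
  proof (rule ccontr)
    assume "\<not> ?thesis"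
    then have "(\<Sum>i<Suc d. Q i * \<phi>) < (\<Sum>i<Suc d. Q i * T i)"
      using Q by (intro sum_strict_mono) (auto simp: not_le)
    with * show False by simp
  qed
  then obtain i where i: "i < Suc d" "T i \<le> \<phi>" by blast
  have "barrier_le (?C i) x \<phi>"
    unfolding barrier_le_def using fs[OF i(1)] i(2) unfolding T_def by blast
  with i(1) show ?thesis unfolding x_def by (rule that)
qed

section \<open>Principal submatrices\<close>

text \<open>An element of a set is located by the number of smaller elements in it. Removing
  \<open>pick \<sigma> i\<close> lowers this number by one just for the elements after it, which is
  the shift made by \<open>insert_index\<close>.\<close>

lemma pick_remove:
  assumes fin: "finite \<sigma>" and j: "j < card \<sigma> - 1" and i: "i < card \<sigma>"
  shows "pick (\<sigma> - {pick \<sigma> i}) j = pick \<sigma> (insert_index i j)"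
proof -
  let ?k = "insert_index i j"
  have k: "?k < card \<sigma>" using i j by (auto simp: insert_index_def)
  have ks: "pick \<sigma> ?k \<in> \<sigma>" using k by (intro pick_in_set_le)
  have neq: "pick \<sigma> ?k \<noteq> pick \<sigma> i"
    using card_pick[of ?k \<sigma>] card_pick[of i \<sigma>] k i by (metis insert_index_exclude)
  have "card {a \<in> \<sigma> - {pick \<sigma> i}. a < pick \<sigma> ?k} = j"
  proof (cases "j < i")
    case True
    then have "pick \<sigma> ?k < pick \<sigma> i" using i by (simp add: pick_mono_le)
    then have "{a \<in> \<sigma> - {pick \<sigma> i}. a < pick \<sigma> ?k} = {a \<in> \<sigma>. a < pick \<sigma> ?k}" by auto
    then show ?thesis using card_pick[of ?k \<sigma>] k True by simp
  next
    case False
    then have "pick \<sigma> i < pick \<sigma> ?k" using k by (intro pick_mono_le) auto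
    then have "{a \<in> \<sigma> - {pick \<sigma> i}. a < pick \<sigma> ?k} = {a \<in> \<sigma>. a < pick \<sigma> ?k} - {pick \<sigma> i}" by auto
    moreover have "pick \<sigma> i \<in> {a \<in> \<sigma>. a < pick \<sigma> ?k}"
      using \<open>pick \<sigma> i < pick \<sigma> ?k\<close> i pick_in_set_le by auto
    ultimately show ?thesis using card_pick[of ?k \<sigma>] k False fin by simp
  qed
  then show ?thesis
    using pick_card_in_set[of "pick \<sigma> ?k" "\<sigma> - {pick \<sigma> i}"] ks neq by auto
qed

lemma submatrix_carrier:
  assumes "A \<in> carrier_mat n n" and "\<sigma> \<subseteq> {0..<n}"
  shows "submatrix A \<sigma> \<sigma> \<in> carrier_mat (card \<sigma>) (card \<sigma>)"
proof -
  have "{i. i < n \<and> i \<in> \<sigma>} = \<sigma>" using assms(2) by auto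
  then show ?thesis using assms(1) by (intro carrier_matI) (simp_all add: dim_submatrix)
qed

text \<open>Turns a deletion into the removal of one index from \<sigma>, so that iterated deletions
  remain principal submatrices of the original \<open>A\<close>.\<close>

lemma mat_delete_submatrix:
  assumes A: "A \<in> carrier_mat n n" and \<sigma>: "\<sigma> \<subseteq> {0..<n}" and i: "i < card \<sigma>"
  shows "mat_delete (submatrix A \<sigma> \<sigma>) i i = submatrix A (\<sigma> - {pick \<sigma> i}) (\<sigma> - {pick \<sigma> i})"
    (is "?L = ?R")
proof -
  let ?\<tau> = "\<sigma> - {pick \<sigma> i}"
  have fin: "finite \<sigma>" using \<sigma> finite_subset by blast
  have ps: "pick \<sigma> i \<in> \<sigma>" using i by (intro pick_in_set_le)
  have card: "card ?\<tau> = card \<sigma> - 1" using fin ps by simp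
  have set: "{i. i < n \<and> i \<in> \<sigma>} = \<sigma>" "{i. i < n \<and> i \<in> ?\<tau>} = ?\<tau>" using \<sigma> by auto
  have S: "submatrix A \<sigma> \<sigma> \<in> carrier_mat (card \<sigma>) (card \<sigma>)" by (rule submatrix_carrier[OF A \<sigma>])
  have R: "?R \<in> carrier_mat (card \<sigma> - 1) (card \<sigma> - 1)"
    using submatrix_carrier[OF A, of ?\<tau>] \<sigma> by (auto simp: card)
  show ?thesis
  proof (rule eq_matI)
    fix j k assume "j < dim_row ?R" "k < dim_col ?R"
    then have jk: "j < card \<sigma> - 1" "k < card \<sigma> - 1" using R by auto
    then have less: "insert_index i j < card \<sigma>" "insert_index i k < card \<sigma>"
      by (auto simp: insert_index_def)
    have suc: "Suc (card \<sigma> - 1) = card \<sigma>" using i by simp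
    have "?L $$ (j, k) = submatrix A \<sigma> \<sigma> $$ (insert_index i j, insert_index i k)"
      using mat_delete_index[of "submatrix A \<sigma> \<sigma>" "card \<sigma> - 1" i i j k] S i jk by (simp add: suc)
    also have "\<dots> = A $$ (pick \<sigma> (insert_index i j), pick \<sigma> (insert_index i k))"
      using A less set by (intro submatrix_index) auto
    also have "\<dots> = A $$ (pick ?\<tau> j, pick ?\<tau> k)"
      using fin jk i by (simp only: pick_remove)
    also have "\<dots> = ?R $$ (j, k)"
      using A jk set card by (intro submatrix_index[symmetric]) auto
    finally show "?L $$ (j, k) = ?R $$ (j, k)" .
  qed (use S R in auto)
qed

text \<open>Each of the \<open>m\<close> deletions moves the barrier left by 1 / \<phi> with \<phi>
  unchanged. Since m < n, every matrix from which an index is deleted has size at least 2.\<close>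

lemma exists_submatrix_barrier_le:
  assumes A: "A \<in> carrier_mat n n" and psd: "psd_mat A" and \<phi>: "0 < \<phi>" and bar: "barrier_le A b \<phi>"
    and m: "m < n"
  shows "\<exists>\<sigma>\<subseteq>{0..<n}. card \<sigma> = n - m \<and> psd_mat (submatrix A \<sigma> \<sigma>) \<and>
    barrier_le (submatrix A \<sigma> \<sigma>) (b - real m / \<phi>) \<phi>"
  using m
proof (induction m)
  case 0
  have pick: "pick {0..<n} i = i" if "i < n" for i
    using pick_reduce_set[of i n UNIV] that by (simp add: pick_UNIV atLeast0LessThan lessThan_def)
  have "submatrix A {0..<n} {0..<n} = A"
    using A submatrix_carrier[OF A, of "{0..<n}"]
    by (intro eq_matI) (auto simp: submatrix_def pick)
  then show ?case using psd bar by (intro exI[of _ "{0..<n}"]) auto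
next
  case (Suc m)
  then obtain \<sigma> where \<sigma>: "\<sigma> \<subseteq> {0..<n}" "card \<sigma> = n - m" "psd_mat (submatrix A \<sigma> \<sigma>)"
      "barrier_le (submatrix A \<sigma> \<sigma>) (b - real m / \<phi>) \<phi>"
    by auto
  define d where "d = n - Suc m"
  have d: "0 < d" "card \<sigma> = Suc d" using Suc.prems \<sigma>(2) by (auto simp: d_def)
  have S: "submatrix A \<sigma> \<sigma> \<in> carrier_mat (Suc d) (Suc d)"
    using submatrix_carrier[OF A \<sigma>(1)] d by simp
  obtain i where i: "i < Suc d"
      "barrier_le (mat_delete (submatrix A \<sigma> \<sigma>) i i) (b - real m / \<phi> - 1 / \<phi>) \<phi>"
    by (rule barrier_le_mat_delete[OF S \<sigma>(3) d(1) \<phi> \<sigma>(4)])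
  let ?\<tau> = "\<sigma> - {pick \<sigma> i}"
  have eq: "mat_delete (submatrix A \<sigma> \<sigma>) i i = submatrix A ?\<tau> ?\<tau>"
    using i(1) d(2) by (intro mat_delete_submatrix[OF A \<sigma>(1)]) simp
  have "finite \<sigma>" "pick \<sigma> i \<in> \<sigma>"
    using \<sigma>(1) i(1) d(2) by (auto simp: finite_subset intro!: pick_in_set_le)
  then have "card ?\<tau> = n - Suc m" using d by (simp add: d_def)
  moreover have "psd_mat (submatrix A ?\<tau> ?\<tau>)"
    using psd_mat_delete[OF S \<sigma>(3) i(1)] by (simp add: eq)
  moreover have "barrier_le (submatrix A ?\<tau> ?\<tau>) (b - real (Suc m) / \<phi>) \<phi>"
    using i(2) unfolding eq by (simp add: add_divide_distrib diff_diff_eq algebra_simps)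
  ultimately show ?case using \<sigma>(1) by blast
qed

section \<open>The norm bound\<close>

lemma op_norm_le:
  assumes "0 \<le> \<mu>" and "\<And>v. v \<in> carrier_vec (dim_col A) \<Longrightarrow> eucl_norm (A *\<^sub>v v) \<le> \<mu> * eucl_norm v"
  shows "op_norm A \<le> \<mu>"
  unfolding op_norm_def
proof (rule cSUP_least)
  have "0\<^sub>v (dim_col A) \<in> {v \<in> carrier_vec (dim_col A). eucl_norm v \<le> 1}"
    using eucl_norm_eq_0_iff[of "0\<^sub>v (dim_col A)" "dim_col A"] by simp
  then show "{v \<in> carrier_vec (dim_col A). eucl_norm v \<le> 1} \<noteq> {}" by blast
  fix v assume v: "v \<in> {v \<in> carrier_vec (dim_col A). eucl_norm v \<le> 1}"
  then have "eucl_norm (A *\<^sub>v v) \<le> \<mu> * eucl_norm v" using assms(2) by blast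
  also have "\<dots> \<le> \<mu>" using v assms(1) by (simp add: mult_left_le)
  finally show "eucl_norm (A *\<^sub>v v) \<le> \<mu>" .
qed

text \<open>The eigenvalues are nonnegative, so lying below \<open>b\<close> bounds their moduli and
  thereby the norm. Positive size provides an eigenvalue, which forces \<open>b\<close> to be
  nonnegative.\<close>

lemma op_norm_le_barrier:
  assumes A: "A \<in> carrier_mat n n" and psd: "psd_mat A" and bar: "barrier_le A b \<phi>" and n: "0 < n"
  shows "op_norm A \<le> b"
proof -
  obtain es where es: "char_poly A = (\<Prod>e\<leftarrow>es. [:- complex_of_real e, 1:])" "\<forall>e\<in>set es. e < b"
    using bar unfolding barrier_le_def by blast
  have rad: "cmod a \<le> b" if a: "eigenvalue A a" for a
  proof -
    obtain r where r: "0 \<le> r" "a = complex_of_real r"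
      using psd_mat_eigenvalue[OF A psd a] .
    have "a \<in> complex_of_real ` set es"
      using a unfolding eigenvalue_root_char_poly[OF A] es(1) poly_prod_list prod_list_zero_iff by auto
    then show ?thesis using r es(2) by auto
  qed
  obtain a where "eigenvalue A a"
    using spectrum_non_empty[OF A n] by (auto simp: spectrum_def)
  then have "0 \<le> b" using rad norm_ge_zero order_trans by blast
  moreover have "hermitian_mat A" using psd by (simp add: psd_mat_def)
  ultimately show ?thesis
    using A by (intro op_norm_le) (auto intro: hermitian_norm_le[OF A _ rad])
qed

section \<open>Trace and eigenvalues of positive contractions\<close>

lemma sum_diag_mult_commute:
  fixes X Y :: "'a::comm_semiring_0 mat"
  assumes X: "X \<in> carrier_mat n m" and Y: "Y \<in> carrier_mat m n"
  shows "(\<Sum>i<n. (X * Y) $$ (i, i)) = (\<Sum>i<m. (Y * X) $$ (i, i))"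
proof -
  have "(\<Sum>i<n. (X * Y) $$ (i, i)) = (\<Sum>i<n. \<Sum>k<m. X $$ (i, k) * Y $$ (k, i))"
    using X Y by (simp add: scalar_prod_def atLeast0LessThan)
  also have "\<dots> = (\<Sum>k<m. \<Sum>i<n. Y $$ (k, i) * X $$ (i, k))"
    by (subst sum.swap) (simp add: mult.commute)
  also have "\<dots> = (\<Sum>i<m. (Y * X) $$ (i, i))"
    using X Y by (simp add: scalar_prod_def atLeast0LessThan)
  finally show ?thesis .
qed

text \<open>The Schur decomposition gives a matrix similar to \<open>A\<close> with diagonal
  \<open>es\<close>, and similarity preserves the trace.\<close>

lemma sum_diag_eq_sum_list_eigenvalues:
  fixes A :: "complex mat"
  assumes A: "A \<in> carrier_mat n n" and es: "char_poly A = (\<Prod>e\<leftarrow>es. [:- e, 1:])"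
  shows "(\<Sum>i<n. A $$ (i, i)) = sum_list es"
proof -
  obtain B P Q where "schur_decomposition A es = (B, P, Q)"
    by (cases "schur_decomposition A es")
  from schur_decomposition[OF A es this]
  have sim: "similar_mat_wit A B P Q" and diag: "diag_mat B = es" by auto
  note wit = similar_mat_witD2[OF A sim]
  have "A = P * (B * Q)"
    unfolding wit(3) by (rule assoc_mult_mat[of _ n n]) (use wit(5-7) in auto)
  then have "(\<Sum>i<n. A $$ (i, i)) = (\<Sum>i<n. (P * (B * Q)) $$ (i, i))"
    by simp
  also have "\<dots> = (\<Sum>i<n. ((B * Q) * P) $$ (i, i))"
    by (rule sum_diag_mult_commute) (use wit(5-7) in auto)
  also have "(B * Q) * P = B * (Q * P)"
    by (rule assoc_mult_mat[of _ n n]) (use wit(5-7) in auto)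
  also have "\<dots> = B"
    unfolding wit(2) using wit(5) by (rule right_mult_one_mat)
  also have "(\<Sum>i<n. B $$ (i, i)) = sum_list es"
    using wit(5) by (simp add: diag[symmetric] diag_mat_def interv_sum_list_conv_sum_set_nat atLeast0LessThan)
  finally show ?thesis .
qed

lemma psd_mat_of_positive_contraction:
  assumes "positive_contraction n A"
  shows "psd_mat A"
proof -
  have "A \<in> carrier_mat n n" and psd: "psd_mat (A - 0\<^sub>m n n)"
    using assms unfolding positive_contraction_def loewner_le_def by blast+
  then have "A - 0\<^sub>m n n = A" by (intro eq_matI) auto
  then show ?thesis using psd by simp
qed

text \<open>The lower bound comes from positivity of \<open>A\<close>, the upper one from positivity
  of \<open>1\<^sub>m n - A\<close>, which has the same eigenvectors with eigenvalues 1 - e. The sum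
  is the trace.\<close>

lemma positive_contraction_eigenvalues:
  assumes pc: "positive_contraction n A" and tr: "normalized_trace A = complex_of_real \<alpha>"
    and n: "n \<ge> 1"
  obtains es where "char_poly A = (\<Prod>e\<leftarrow>es. [:- complex_of_real e, 1:])" "length es = n"
    "\<And>e. e \<in> set es \<Longrightarrow> 0 \<le> e \<and> e \<le> 1" "sum_list es = real n * \<alpha>"
proof -
  have A: "A \<in> carrier_mat n n" and psd1: "psd_mat (1\<^sub>m n - A)"
    using pc unfolding positive_contraction_def loewner_le_def by blast+
  obtain es where es: "char_poly A = (\<Prod>e\<leftarrow>es. [:- complex_of_real e, 1:])" "length es = n"
    "\<And>e. e \<in> set es \<Longrightarrow> 0 \<le> e"
    "\<And>e. eigenvalue A (complex_of_real e) \<longleftrightarrow> e \<in> set es"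
    using psd_mat_char_poly_factorized[OF A psd_mat_of_positive_contraction[OF pc]] by metis
  have le1: "e \<le> 1" if e: "e \<in> set es" for e
  proof -
    obtain u where u: "u \<in> carrier_vec n" "u \<noteq> 0\<^sub>v n" "A *\<^sub>v u = complex_of_real e \<cdot>\<^sub>v u"
      using es(4)[of e] e A unfolding eigenvalue_def eigenvector_def by auto
    have "(1\<^sub>m n - A) *\<^sub>v u = u - complex_of_real e \<cdot>\<^sub>v u"
      using A u by (simp add: minus_mult_distrib_mat_vec[of _ n n])
    also have "\<dots> = complex_of_real (1 - e) \<cdot>\<^sub>v u"
      using u(1) by (intro eq_vecI) (auto simp: algebra_simps)
    finally have "eigenvalue (1\<^sub>m n - A) (complex_of_real (1 - e))"
      using u A unfolding eigenvalue_def eigenvector_def by auto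
    from psd_mat_eigenvalue[OF _ psd1 this] obtain r where "0 \<le> r" "complex_of_real (1 - e) = complex_of_real r"
      using A by (metis minus_carrier_mat)
    then show ?thesis by (simp only: of_real_eq_iff)
  qed
  have "complex_of_real (sum_list es) = sum_list (map complex_of_real es)"
    by (induction es) auto
  also have "\<dots> = (\<Sum>i<n. A $$ (i, i))"
    using sum_diag_eq_sum_list_eigenvalues[OF A, of "map complex_of_real es"] es(1)
    by (simp add: comp_def)
  also have "\<dots> = complex_of_real (real n * \<alpha>)"
    using tr A n by (simp add: normalized_trace_def field_simps)
  finally have sum: "sum_list es = real n * \<alpha>"
    unfolding of_real_eq_iff .
  show ?thesis
    using es le1 sum by (intro that[of es]) auto
qed

text \<open>On \<open>[0, 1]\<close> the convex function \<open>e \<mapsto> 1 / (b - e)\<close> lies below its chord.\<close>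

lemma positive_contraction_barrier_le:
  assumes pc: "positive_contraction n A" and tr: "normalized_trace A = complex_of_real \<alpha>"
    and n: "n \<ge> 1" and b: "1 < b"
  shows "barrier_le A b (real n * ((1 - \<alpha>) / b + \<alpha> / (b - 1)))"
proof -
  obtain es where es: "char_poly A = (\<Prod>e\<leftarrow>es. [:- complex_of_real e, 1:])" "length es = n"
    and e01: "\<And>e. e \<in> set es \<Longrightarrow> 0 \<le> e \<and> e \<le> 1" and sum: "sum_list es = real n * \<alpha>"
    using positive_contraction_eigenvalues[OF pc tr n] by metis
  have "(\<Sum>e\<leftarrow>es. 1 / (b - e)) \<le> (\<Sum>e\<leftarrow>es. (1 - e) / b + e / (b - 1))"
  proof (rule sum_list_mono)
    fix e assume e: "e \<in> set es"
    have "(1 - e) / b + e / (b - 1) - 1 / (b - e) = e * (1 - e) / (b * (b - 1) * (b - e))"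
      using e01[OF e] b by (simp add: divide_simps) (simp add: algebra_simps power2_eq_square)
    also have "\<dots> \<ge> 0" using e01[OF e] b by simp
    finally show "1 / (b - e) \<le> (1 - e) / b + e / (b - 1)" by simp
  qed
  also have "\<dots> = (real (length es) - sum_list es) / b + sum_list es / (b - 1)"
    by (induction es) (auto simp: add_divide_distrib diff_divide_distrib)
  also have "\<dots> = real n * ((1 - \<alpha>) / b + \<alpha> / (b - 1))"
    by (simp add: sum es(2) algebra_simps diff_divide_distrib)
  finally show "barrier_le A b (real n * ((1 - \<alpha>) / b + \<alpha> / (b - 1)))"
    unfolding barrier_le_def using es(1) e01 b by fastforce
qed

text \<open>Starting the barrier at \<open>b = t + 1 - \<alpha>\<close> makes the final position \<open>c t + (1 - c) \<alpha> (1 - \<alpha>) / t + \<dots>\<close>,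
  which is minimal at \<open>t\<^sub>0 = sqrt ((1 - c) \<alpha> (1 - \<alpha>) / c)\<close>. As \<open>b > 1\<close> is needed and \<open>t\<^sub>0 = \<alpha>\<close> is
  possible, \<open>t\<close> only tends to \<open>t\<^sub>0\<close> from above.\<close>

theorem theorem1p7:
  fixes n :: nat and A :: "complex mat" and \<alpha> c :: real
  assumes "n \<ge> 1"
    and "positive_contraction n A"
    and "normalized_trace A = complex_of_real \<alpha>"
    and "0 < c" and "c \<le> 1 - \<alpha>"
    and "c * real n \<in> \<int>"
  shows "\<exists>\<sigma> \<subseteq> {0..<n}. real (card \<sigma>) = c * real n \<and>
    op_norm (submatrix A \<sigma> \<sigma>) \<le> (sqrt ((1 - c) * \<alpha>) + sqrt (c * (1 - \<alpha>)))\<^sup>2"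
proof -
  have A: "A \<in> carrier_mat n n" using assms(2) by (simp add: positive_contraction_def)
  note psd = psd_mat_of_positive_contraction[OF assms(2)]
  note start = positive_contraction_barrier_le[OF assms(2,3,1)]
  have \<alpha>0: "0 \<le> \<alpha>"
  proof -
    obtain es where "\<And>e. e \<in> set es \<Longrightarrow> 0 \<le> e \<and> e \<le> 1" "sum_list es = real n * \<alpha>"
      using positive_contraction_eigenvalues[OF assms(2,3,1)] by metis
    then have "0 \<le> real n * \<alpha>" by (metis sum_list_nonneg)
    then show ?thesis using assms(1) by (simp add: zero_le_mult_iff)
  qed
  have c: "0 < c" "c \<le> 1" and \<alpha>1: "\<alpha> < 1" using assms \<alpha>0 by auto
  obtain k where k: "c * real n = real k"
    using assms(1,6) c by (metis Ints_cases mult_nonneg_nonneg less_imp_le of_nat_0_le_iff of_int_0_le_iff of_int_of_nat_eq zero_le_imp_eq_int)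
  have k_pos: "0 < k" using k c assms(1) by (metis gr0I less_numeral_extra(3) mult_eq_0_iff not_one_le_zero of_nat_eq_0_iff)
  have k_le: "k \<le> n"
    using mult_right_mono[OF c(2), of "real n"] k by simp
  define R where "R = (sqrt ((1 - c) * \<alpha>) + sqrt (c * (1 - \<alpha>)))\<^sup>2"
  define s where "s = sqrt ((1 - c) * \<alpha>) * sqrt (c * (1 - \<alpha>))"
  \<comment> \<open>If t0 > 0, both terms c t and (1 - c) \<alpha> (1 - \<alpha>) / t equal
    \<open>s\<close> at t = t0, so together they give the cross term \<open>2 * s\<close> of
    \<open>R\<close>.\<close>
  define t0 where "t0 = s / c"
  have R: "R = (1 - c) * \<alpha> + c * (1 - \<alpha>) + 2 * s"
    unfolding R_def s_def using c \<alpha>0 \<alpha>1 by (simp add: power2_sum)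
  have s2: "s\<^sup>2 = (1 - c) * \<alpha> * (c * (1 - \<alpha>))"
    unfolding s_def using c \<alpha>0 \<alpha>1 by (simp add: power_mult_distrib)
  have s0: "0 \<le> s" unfolding s_def using c \<alpha>0 \<alpha>1 by simp
  \<comment> \<open>Expanded, this is the hypothesis c + \<alpha> \<le> 1. It yields \<alpha> \<le>
    t0, so the optimal starting barrier t0 + 1 - \<alpha> is at least 1.\<close>
  have "c * \<alpha> \<le> (1 - c) * (1 - \<alpha>)" using assms(5) by (simp add: algebra_simps)
  then have "c * \<alpha> * (c * \<alpha>) \<le> c * \<alpha> * ((1 - c) * (1 - \<alpha>))"
    using c \<alpha>0 by (intro mult_left_mono) auto
  then have "(c * \<alpha>)\<^sup>2 \<le> s\<^sup>2" unfolding s2 by (simp add: power2_eq_square algebra_simps)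
  then have t0_ge: "\<alpha> \<le> t0"
    using power2_le_imp_le[OF _ s0] c by (simp add: t0_def field_simps)
  have main: "\<exists>\<sigma>\<subseteq>{0..<n}. card \<sigma> = k \<and> op_norm (submatrix A \<sigma> \<sigma>) \<le> R + \<epsilon>" if \<epsilon>: "0 < \<epsilon>" for \<epsilon>
  proof -
    \<comment> \<open>The excess \<epsilon> / c puts \<open>b\<close> strictly above 1 and raises
      the term \<open>c * t\<close> by exactly \<epsilon>.\<close>
    define t where "t = t0 + \<epsilon> / c"
    have "0 < \<epsilon> / c" using \<epsilon> c by simp
    then have t: "\<alpha> < t" "t0 < t" "0 < t" using t0_ge \<alpha>0 unfolding t_def by linarith+
    define b where "b = t + 1 - \<alpha>"
    have b: "1 < b" using t by (simp add: b_def)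
    define \<phi> where "\<phi> = real n * ((1 - \<alpha>) / b + \<alpha> / (b - 1))"
    \<comment> \<open>Over the common denominator the numerator is b - 1 + \<alpha>, which is
      \<open>t\<close>.\<close>
    have \<phi>: "\<phi> = real n * t / (b * (b - 1))"
      unfolding \<phi>_def using b by (simp add: b_def field_simps)
    have \<phi>0: "0 < \<phi>" unfolding \<phi> using assms(1) t b by simp
    obtain \<sigma> where \<sigma>: "\<sigma> \<subseteq> {0..<n}" "card \<sigma> = k" "psd_mat (submatrix A \<sigma> \<sigma>)"
      "barrier_le (submatrix A \<sigma> \<sigma>) (b - real (n - k) / \<phi>) \<phi>"
      using exists_submatrix_barrier_le[OF A psd \<phi>0 start[OF b, folded \<phi>_def], of "n - k"] k_pos k_le
      by auto
    have "op_norm (submatrix A \<sigma> \<sigma>) \<le> b - real (n - k) / \<phi>"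
      using submatrix_carrier[OF A \<sigma>(1)] \<sigma>(2-4) k_pos by (intro op_norm_le_barrier) auto
    also have "real (n - k) / \<phi> = (1 - c) * (b * (b - 1)) / t"
    proof -
      have "real (n - k) = (1 - c) * real n" using k k_le by (simp add: of_nat_diff algebra_simps)
      then show ?thesis unfolding \<phi> using assms(1) t b by simp
    qed
    also have "b - \<dots> = (1 - c) * \<alpha> + c * (1 - \<alpha>) + c * t + (1 - c) * \<alpha> * (1 - \<alpha>) / t"
      unfolding b_def using t by (simp add: field_simps)
    also have "(1 - c) * \<alpha> * (1 - \<alpha>) / t \<le> s"
    proof -
      have "(1 - c) * \<alpha> * (1 - \<alpha>) = s * t0"
        using s2 c by (simp add: t0_def power2_eq_square field_simps)
      also have "\<dots> \<le> s * t" using s0 t by (intro mult_left_mono) auto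
      finally show ?thesis using t by (simp add: field_simps)
    qed
    also have "(1 - c) * \<alpha> + c * (1 - \<alpha>) + c * t + s = R + \<epsilon>"
      using c by (simp add: R t_def t0_def field_simps)
    finally show ?thesis using \<sigma> by auto
  qed
  \<comment> \<open>Only finitely many index sets have size \<open>k\<close>, so one of minimal norm
    satisfies the bound for all \<epsilon> at once.\<close>
  define F where "F = {\<sigma>. \<sigma> \<subseteq> {0..<n} \<and> card \<sigma> = k}"
  have fin: "finite F" unfolding F_def by (rule finite_subset[of _ "Pow {0..<n}"]) auto
  have ne: "F \<noteq> {}" using main[of 1] unfolding F_def by auto
  let ?f = "\<lambda>\<sigma>. op_norm (submatrix A \<sigma> \<sigma>)"
  have "Min (?f ` F) \<in> ?f ` F" using fin ne by (intro Min_in) auto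
  then obtain \<sigma> where \<sigma>: "\<sigma> \<in> F" "?f \<sigma> = Min (?f ` F)" by auto
  have "?f \<sigma> \<le> R"
  proof (rule field_le_epsilon)
    fix \<epsilon> :: real assume "0 < \<epsilon>"
    from main[OF this] obtain \<tau> where "\<tau> \<in> F" "?f \<tau> \<le> R + \<epsilon>" by (auto simp: F_def)
    moreover have "?f \<sigma> \<le> ?f \<tau>" unfolding \<sigma>(2) using fin \<open>\<tau> \<in> F\<close> by simp
    ultimately show "?f \<sigma> \<le> R + \<epsilon>" by simp
  qed
  then show ?thesis using \<sigma>(1) k unfolding F_def R_def by auto
qed

end
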